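(* Let $x,y:M\to\mathbb C$ be holomorphic functions with $x-y\neq 0$ on $M$, and let $\mu(w)=\dfrac{e^{i\theta(w)}}{|x(w)-y(w)|}$ with $\theta:M\to\mathbb R$ smooth. Then the spherical condition $$|\mu|=\frac1{|x-y|},\qquad \frac{\mu_w}{\mu}=\frac{-x_w}{x-y}+\frac{\bar y_w}{\bar x-\bar y},\qquad \frac{\mu_{\bar w}}{\mu}=\frac{-x_{\bar w}}{x-y}+\frac{\bar y_{\bar w}}{\bar x-\bar y}$$ for $\mu$ in this polar form is $$\theta_w=\frac i2\,\frac{x'+y'}{x-y}.$$ Therefore, under this condition, the real valued function $\theta$ is harmonic in $M$.
   Context: $M\subset\mathbb C$ is open, connected and simply connected, with points $w=u+iv$; $\partial_w=\frac12(\partial_u-i\partial_v)$, $\partial_{\bar w}=\frac12(\partial_u+i\partial_v)$; subscripts denote these derivatives, $\bar y_w=\partial_w(\bar y)$, and primes denote complex derivatives. *)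

theory Defs
  imports "HOL-Analysis.Analysis"
begin

text \<open>Real partial derivatives in the coordinates \<open>w = u + i v\<close>.\<close>

definition partial_u :: "(complex \<Rightarrow> 'a::real_normed_vector) \<Rightarrow> complex \<Rightarrow> 'a" where
  "partial_u f w = vector_derivative (\<lambda>t::real. f (w + of_real t)) (at 0)"

definition partial_v :: "(complex \<Rightarrow> 'a::real_normed_vector) \<Rightarrow> complex \<Rightarrow> 'a" where
  "partial_v f w = vector_derivative (\<lambda>t::real. f (w + \<i> * of_real t)) (at 0)"

text \<open>The Wirtinger operators \<open>\<partial>\<^sub>w\<close> and \<open>\<partial>\<^bsub>cnj w\<^esub>\<close>.\<close>

definition wirt :: "(complex \<Rightarrow> complex) \<Rightarrow> complex \<Rightarrow> complex" where
  "wirt f w = (partial_u f w - \<i> * partial_v f w) / 2"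

definition wirt_bar :: "(complex \<Rightarrow> complex) \<Rightarrow> complex \<Rightarrow> complex" where
  "wirt_bar f w = (partial_u f w + \<i> * partial_v f w) / 2"

text \<open>\<open>Ck_on k f M\<close> is meant for open \<open>M\<close>, where it is \<open>C\<^sup>k\<close> smoothness in the real sense.
  Differentiability is total (Frechet) real differentiability at each point; it guarantees that the
  partial derivatives used in the recursion are genuine.\<close>

primrec Ck_on :: "nat \<Rightarrow> (complex \<Rightarrow> 'a::real_normed_vector) \<Rightarrow> complex set \<Rightarrow> bool" where
  "Ck_on 0 f M \<longleftrightarrow> continuous_on M f"
| "Ck_on (Suc k) f M \<longleftrightarrow>
     f differentiable_on M \<and> Ck_on k (partial_u f) M \<and> Ck_on k (partial_v f) M"

definition smooth_on :: "(complex \<Rightarrow> 'a::real_normed_vector) \<Rightarrow> complex set \<Rightarrow> bool" where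
  "smooth_on f M \<longleftrightarrow> (\<forall>k. Ck_on k f M)"

definition harmonic_on :: "(complex \<Rightarrow> real) \<Rightarrow> complex set \<Rightarrow> bool" where
  "harmonic_on f M \<longleftrightarrow>
     Ck_on 2 f M \<and> (\<forall>w\<in>M. partial_u (partial_u f) w + partial_v (partial_v f) w = 0)"

definition spherical_condition ::
  "complex set \<Rightarrow> (complex \<Rightarrow> complex) \<Rightarrow> (complex \<Rightarrow> complex) \<Rightarrow> (complex \<Rightarrow> complex) \<Rightarrow> bool" where
  "spherical_condition M x y \<mu> \<longleftrightarrow>
     (\<forall>w\<in>M.
        cmod (\<mu> w) = 1 / cmod (x w - y w) \<and>
        wirt \<mu> w / \<mu> w =
          - wirt x w / (x w - y w) + wirt (\<lambda>z. cnj (y z)) w / (cnj (x w) - cnj (y w)) \<and>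
        wirt_bar \<mu> w / \<mu> w =
          - wirt_bar x w / (x w - y w) + wirt_bar (\<lambda>z. cnj (y z)) w / (cnj (x w) - cnj (y w)))"

end

theory Submission
  imports Defs "HOL-Complex_Analysis.Cauchy_Integral_Formula"
begin

text \<open>
  Put \<open>d = x - y\<close>. Formally \<open>log \<mu> = \<i> \<theta> - (log d + log (cnj d)) / 2\<close>, and \<open>\<partial>\<^sub>w\<close> kills the
  antiholomorphic summand while \<open>\<partial>\<^bsub>cnj w\<^esub>\<close> kills the holomorphic one, so that
  \<open>\<mu>\<^sub>w / \<mu> = \<i> \<theta>\<^sub>w - d' / (2 d)\<close> and \<open>\<mu>\<^bsub>cnj w\<^esub> / \<mu> = \<i> cnj \<theta>\<^sub>w - cnj (d' / (2 d))\<close>, since \<open>\<theta>\<close> is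
  real (\<open>wirtinger_log_derivatives_polar\<close>). On the right-hand sides of the spherical condition the
  terms \<open>\<partial>\<^sub>w (cnj y)\<close> and \<open>\<partial>\<^bsub>cnj w\<^esub> x\<close> vanish, and what remains of each of the two equations is
  \<open>\<theta>\<^sub>w = \<i> (x' + y') / (2 d)\<close>, the second one in conjugated form. The modulus equation is
  automatic in polar form.

  The right-hand side \<open>g\<close> of this equation is holomorphic. As \<open>\<theta>\<close> is real, \<open>\<theta>\<^sub>w = g\<close> gives both real
  partial derivatives, \<open>\<theta>\<^sub>u = 2 Re g\<close> and \<open>\<theta>\<^sub>v = - 2 Im g\<close>; differentiating once more,
  \<open>\<theta>\<^bsub>uu\<^esub> = 2 Re g'\<close> and \<open>\<theta>\<^bsub>vv\<^esub> = - 2 Im (\<i> g') = - 2 Re g'\<close>, so the Laplacian is zero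
  (\<open>laplacian_zero_if_wirt_holomorphic\<close>).
\<close>

lemma has_vector_derivative_along_line:
  fixes f :: "complex \<Rightarrow> 'a::real_normed_vector"
  assumes "(f has_derivative F) (at w)"
  shows "((\<lambda>t::real. f (w + e * of_real t)) has_vector_derivative F e) (at 0)"
proof -
  have line: "((\<lambda>t::real. w + e * of_real t) has_derivative (\<lambda>t. e * of_real t)) (at 0)"
    by (auto intro!: derivative_eq_intros)
  have "(f \<circ> (\<lambda>t::real. w + e * of_real t) has_derivative F \<circ> (\<lambda>t. e * of_real t)) (at 0)"
    by (rule diff_chain_at[OF line]) (simp add: assms)
  moreover have "F (e * of_real t) = t *\<^sub>R F e" for t
    using linear_scale[OF has_derivative_linear[OF assms], of t e]
    by (simp add: scaleR_conv_of_real mult.commute)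
  ultimately show ?thesis
    by (simp add: has_vector_derivative_def o_def)
qed

lemma partial_u_eq:
  assumes "(f has_derivative F) (at w)"
  shows "partial_u f w = F 1"
  using has_vector_derivative_along_line[OF assms, of 1]
  unfolding partial_u_def by (simp add: vector_derivative_at)

lemma partial_v_eq:
  assumes "(f has_derivative F) (at w)"
  shows "partial_v f w = F \<i>"
  using has_vector_derivative_along_line[OF assms, of \<i>]
  unfolding partial_v_def by (simp add: vector_derivative_at)

lemma wirt_eq:
  assumes "(f has_derivative F) (at w)"
  shows "wirt f w = (F 1 - \<i> * F \<i>) / 2"
  by (simp add: wirt_def partial_u_eq[OF assms] partial_v_eq[OF assms])

lemma wirt_bar_eq:
  assumes "(f has_derivative F) (at w)"
  shows "wirt_bar f w = (F 1 + \<i> * F \<i>) / 2"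
  by (simp add: wirt_bar_def partial_u_eq[OF assms] partial_v_eq[OF assms])

lemma wirtinger_holomorphic:
  assumes "(f has_field_derivative D) (at w)"
  shows "wirt f w = D" "wirt_bar f w = 0"
    "wirt (\<lambda>z. cnj (f z)) w = 0" "wirt_bar (\<lambda>z. cnj (f z)) w = cnj D"
proof -
  have f: "(f has_derivative (\<lambda>h. D * h)) (at w)"
    using assms by (simp add: has_field_derivative_def)
  have cnj_f: "((\<lambda>z. cnj (f z)) has_derivative (\<lambda>h. cnj (D * h))) (at w)"
    by (rule has_derivative_cnj[OF f])
  show "wirt f w = D" "wirt_bar f w = 0"
    by (simp_all add: wirt_eq[OF f] wirt_bar_eq[OF f] algebra_simps)
  show "wirt (\<lambda>z. cnj (f z)) w = 0" "wirt_bar (\<lambda>z. cnj (f z)) w = cnj D"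
    by (simp_all add: wirt_eq[OF cnj_f] wirt_bar_eq[OF cnj_f] algebra_simps)
qed

lemma wirt_of_real:
  assumes "(\<theta> has_derivative T) (at w)"
  shows "wirt (\<lambda>z. complex_of_real (\<theta> z)) w = Complex (T 1 / 2) (- T \<i> / 2)"
  by (simp add: wirt_eq[OF has_derivative_of_real[OF assms]] complex_eq_iff)

text \<open>
  In a direction \<open>h\<close>, the real function \<open>log (cmod d)\<close> grows at the rate \<open>Re (h D / d)\<close>, which is why the
  logarithmic derivative of \<open>\<mu>\<close> along \<open>h\<close> is \<open>\<i> T h - Re (h D / d)\<close>. Unlike
  \<open>log d\<close>, this involves no choice of a branch. The Wirtinger combinations of \<open>h \<mapsto> Re (h c)\<close> are
  \<open>c / 2\<close> and \<open>cnj c / 2\<close>.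
\<close>
lemma wirtinger_log_derivatives_polar:
  assumes "open M" "w \<in> M"
    and \<mu>: "\<And>z. z \<in> M \<Longrightarrow>
      \<mu> z = exp (\<i> * complex_of_real (\<theta> z)) / complex_of_real (cmod (d z))"
    and \<theta>: "(\<theta> has_derivative T) (at w)"
    and d: "(d has_field_derivative D) (at w)" and nz: "d w \<noteq> 0"
  shows "wirt \<mu> w / \<mu> w = \<i> * wirt (\<lambda>z. complex_of_real (\<theta> z)) w - D / (2 * d w)"
    and "wirt_bar \<mu> w / \<mu> w =
      \<i> * cnj (wirt (\<lambda>z. complex_of_real (\<theta> z)) w) - cnj (D / (2 * d w))"
proof -
  define c where "c = D / d w"
  have D_eq: "D = d w * c"
    using nz by (simp add: c_def)
  define E where "E = exp (\<i> * complex_of_real (\<theta> w))"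
  have d': "(d has_derivative (\<lambda>h. D * h)) (at w)"
    using d by (simp add: has_field_derivative_def)
  have expd: "((\<lambda>z. exp (\<i> * complex_of_real (\<theta> z))) has_derivative
      (\<lambda>h. E * (\<i> * complex_of_real (T h)))) (at w)"
  proof -
    have "((\<lambda>z. \<i> * complex_of_real (\<theta> z)) has_derivative
        (\<lambda>h. \<i> * complex_of_real (T h))) (at w)"
      by (intro has_derivative_mult_right has_derivative_of_real \<theta>)
    from diff_chain_at[OF this, of exp "\<lambda>h. E * h"]
    show ?thesis
      using DERIV_exp[of "\<i> * complex_of_real (\<theta> w)"]
      by (simp add: o_def E_def has_field_derivative_def)
  qed
  have normd: "((\<lambda>z. cmod (d z)) has_derivative (\<lambda>h. cmod (d w) * Re (c * h))) (at w)"
  proof -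
    have "((\<lambda>z. cmod (d z)) has_derivative (\<lambda>h. inner (D * h) (sgn (d w)))) (at w)"
      using diff_chain_at[OF d' has_derivative_norm[OF nz]] by (simp add: o_def)
    moreover have "inner (D * h) (sgn (d w)) = cmod (d w) * Re (c * h)" for h
    proof -
      have "inner (D * h) (sgn (d w)) = Re (D * h * cnj (d w)) / cmod (d w)"
        by (simp add: inner_complex_def sgn_div_norm divide_inverse algebra_simps)
      also have "D * h * cnj (d w) = complex_of_real ((cmod (d w))\<^sup>2) * (c * h)"
        by (simp only: D_eq complex_norm_square mult.assoc mult.commute mult.left_commute)
      also have "Re (complex_of_real ((cmod (d w))\<^sup>2) * (c * h)) / cmod (d w)
          = cmod (d w) * Re (c * h)"
        using nz by (simp add: power2_eq_square del: of_real_power)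
      finally show ?thesis .
    qed
    ultimately show ?thesis by simp
  qed
  have \<mu>w: "\<mu> w = E / complex_of_real (cmod (d w))"
    using \<mu>[OF \<open>w \<in> M\<close>] by (simp add: E_def)
  have \<mu>_nz: "\<mu> w \<noteq> 0"
    using nz by (simp add: \<mu>w E_def)
  have \<mu>d: "(\<mu> has_derivative (\<lambda>h. \<mu> w * (\<i> * of_real (T h) - of_real (Re (c * h))))) (at w)"
  proof -
    have "((\<lambda>z. exp (\<i> * complex_of_real (\<theta> z)) / complex_of_real (cmod (d z))) has_derivative
        (\<lambda>h. \<mu> w * (\<i> * of_real (T h) - of_real (Re (c * h))))) (at w)"
      by (rule has_derivative_eq_rhs[OF has_derivative_divide'[OF expd has_derivative_of_real[OF normd]]])
        (use nz in \<open>auto simp: \<mu>w E_def fun_eq_iff field_simps\<close>)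
    from has_derivative_transform_within_open[OF this \<open>open M\<close> \<open>w \<in> M\<close>] \<mu>
    show ?thesis by simp
  qed
  have \<theta>w: "wirt (\<lambda>z. complex_of_real (\<theta> z)) w = Complex (T 1 / 2) (- T \<i> / 2)"
    by (rule wirt_of_real[OF \<theta>])
  have c2: "D / (2 * d w) = c / 2"
    by (simp add: c_def)
  have "wirt \<mu> w = \<mu> w * (\<i> * Complex (T 1 / 2) (- T \<i> / 2) - c / 2)"
    by (simp add: wirt_eq[OF \<mu>d] complex_eq_iff field_simps)
  then show "wirt \<mu> w / \<mu> w = \<i> * wirt (\<lambda>z. complex_of_real (\<theta> z)) w - D / (2 * d w)"
    using \<mu>_nz by (simp add: \<theta>w c2)
  have "wirt_bar \<mu> w = \<mu> w * (\<i> * cnj (Complex (T 1 / 2) (- T \<i> / 2)) - cnj (c / 2))"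
    by (simp add: wirt_bar_eq[OF \<mu>d] complex_eq_iff field_simps)
  then show "wirt_bar \<mu> w / \<mu> w =
      \<i> * cnj (wirt (\<lambda>z. complex_of_real (\<theta> z)) w) - cnj (D / (2 * d w))"
    using \<mu>_nz unfolding \<theta>w c2 by simp
qed

text \<open>
  For real \<open>\<theta>\<close> the complex equation \<open>\<theta>\<^sub>w = g\<close> determines the two real partial derivatives separately:
  they are \<open>2 Re g\<close> and \<open>- 2 Im g\<close>, whose derivatives are read off from \<open>g'\<close>.
\<close>
lemma laplacian_zero_if_wirt_holomorphic:
  assumes "open M" and \<theta>: "\<theta> differentiable_on M" and g: "g holomorphic_on M"
    and eq: "\<And>z. z \<in> M \<Longrightarrow> wirt (\<lambda>z. complex_of_real (\<theta> z)) z = g z"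
    and "w \<in> M"
  shows "partial_u (partial_u \<theta>) w + partial_v (partial_v \<theta>) w = 0"
proof -
  have partials: "2 * Re (g z) = partial_u \<theta> z \<and> - 2 * Im (g z) = partial_v \<theta> z"
    if z: "z \<in> M" for z
  proof -
    obtain T where T: "(\<theta> has_derivative T) (at z)"
      using \<theta> \<open>open M\<close> z
      by (auto simp: differentiable_on_eq_differentiable_at differentiable_def)
    show ?thesis
      by (simp add: wirt_of_real[OF T] partial_u_eq[OF T] partial_v_eq[OF T] flip: eq[OF z])
  qed
  have g': "(g has_derivative (\<lambda>h. deriv g w * h)) (at w)"
    using holomorphic_derivI[OF g \<open>open M\<close> \<open>w \<in> M\<close>] by (simp add: has_field_derivative_def)
  have "((\<lambda>z. 2 * Re (g z)) has_derivative (\<lambda>h. 2 * Re (deriv g w * h))) (at w)"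
    by (intro has_derivative_mult_right has_derivative_Re g')
  then have u: "(partial_u \<theta> has_derivative (\<lambda>h. 2 * Re (deriv g w * h))) (at w)"
    by (rule has_derivative_transform_within_open[OF _ \<open>open M\<close> \<open>w \<in> M\<close>]) (use partials in simp)
  have "((\<lambda>z. - 2 * Im (g z)) has_derivative (\<lambda>h. - 2 * Im (deriv g w * h))) (at w)"
    by (intro has_derivative_mult_right has_derivative_Im g')
  then have v: "(partial_v \<theta> has_derivative (\<lambda>h. - 2 * Im (deriv g w * h))) (at w)"
    by (rule has_derivative_transform_within_open[OF _ \<open>open M\<close> \<open>w \<in> M\<close>]) (use partials in simp)
  show ?thesis
    by (simp add: partial_u_eq[OF u] partial_v_eq[OF v])
qed

theorem lemma7p4:
  fixes M :: "complex set" and x y \<mu> :: "complex \<Rightarrow> complex" and \<theta> :: "complex \<Rightarrow> real"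
  assumes "open M" and "connected M" and "simply_connected M"
    and "x holomorphic_on M" and "y holomorphic_on M"
    and "\<And>w. w \<in> M \<Longrightarrow> x w - y w \<noteq> 0"
    and "smooth_on \<theta> M"
    and "\<And>w. w \<in> M \<Longrightarrow>
           \<mu> w = exp (\<i> * complex_of_real (\<theta> w)) / complex_of_real (cmod (x w - y w))"
  shows "(spherical_condition M x y \<mu> \<longleftrightarrow>
            (\<forall>w\<in>M. wirt (\<lambda>z. complex_of_real (\<theta> z)) w
                     = \<i> / 2 * ((deriv x w + deriv y w) / (x w - y w))))
         \<and> (spherical_condition M x y \<mu> \<longrightarrow> harmonic_on \<theta> M)"
proof -
  let ?\<theta>w = "wirt (\<lambda>z. complex_of_real (\<theta> z))"
  define g where "g = (\<lambda>w. \<i> / 2 * ((deriv x w + deriv y w) / (x w - y w)))"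
  have diff: "\<theta> differentiable_on M"
    using \<open>smooth_on \<theta> M\<close> unfolding smooth_on_def by (metis Ck_on.simps(2))
  have pointwise: "(cmod (\<mu> w) = 1 / cmod (x w - y w) \<and>
      wirt \<mu> w / \<mu> w =
        - wirt x w / (x w - y w) + wirt (\<lambda>z. cnj (y z)) w / (cnj (x w) - cnj (y w)) \<and>
      wirt_bar \<mu> w / \<mu> w =
        - wirt_bar x w / (x w - y w) + wirt_bar (\<lambda>z. cnj (y z)) w / (cnj (x w) - cnj (y w)))
    \<longleftrightarrow> ?\<theta>w w = g w" if w: "w \<in> M" for w
  proof -
    have nz: "x w - y w \<noteq> 0" by (rule assms(6)[OF w])
    have x': "(x has_field_derivative deriv x w) (at w)"
      and y': "(y has_field_derivative deriv y w) (at w)"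
      using assms(1,4,5) w by (auto intro: holomorphic_derivI)
    obtain T where T: "(\<theta> has_derivative T) (at w)"
      using diff \<open>open M\<close> w
      by (auto simp: differentiable_on_eq_differentiable_at differentiable_def)
    have modulus: "cmod (\<mu> w) = 1 / cmod (x w - y w)"
      by (simp add: assms(8)[OF w] norm_divide)
    define X Y where "X = deriv x w / (x w - y w)" and "Y = deriv y w / (x w - y w)"
    have half: "(deriv x w - deriv y w) / (2 * (x w - y w)) = (X - Y) / 2"
      using nz by (simp add: X_def Y_def flip: diff_divide_distrib)
    have log_derivs: "wirt \<mu> w / \<mu> w = \<i> * ?\<theta>w w - (X - Y) / 2"
      "wirt_bar \<mu> w / \<mu> w = \<i> * cnj (?\<theta>w w) - cnj ((X - Y) / 2)"
      using wirtinger_log_derivatives_polar[where d = "\<lambda>z. x z - y z",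
        OF \<open>open M\<close> w assms(8) T DERIV_diff[OF x' y'] nz]
      by (simp_all only: half)
    have g_eq: "g w = \<i> / 2 * (X + Y)"
      by (simp add: g_def X_def Y_def add_divide_distrib)
    have first: "wirt \<mu> w / \<mu> w =
        - wirt x w / (x w - y w) + wirt (\<lambda>z. cnj (y z)) w / (cnj (x w) - cnj (y w))
      \<longleftrightarrow> ?\<theta>w w = g w"
    proof -
      have rhs: "- wirt x w / (x w - y w) + wirt (\<lambda>z. cnj (y z)) w / (cnj (x w) - cnj (y w)) = - X"
        by (simp add: wirtinger_holomorphic[OF x'] wirtinger_holomorphic[OF y'] X_def)
      show ?thesis
        unfolding log_derivs(1) rhs g_eq by (auto simp: complex_eq_iff field_simps)
    qed
    have second: "wirt_bar \<mu> w / \<mu> w =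
        - wirt_bar x w / (x w - y w) + wirt_bar (\<lambda>z. cnj (y z)) w / (cnj (x w) - cnj (y w))
      \<longleftrightarrow> ?\<theta>w w = g w"
    proof -
      have rhs: "- wirt_bar x w / (x w - y w)
          + wirt_bar (\<lambda>z. cnj (y z)) w / (cnj (x w) - cnj (y w)) = cnj Y"
        by (simp add: wirtinger_holomorphic[OF x'] wirtinger_holomorphic[OF y'] Y_def)
      show ?thesis
        unfolding log_derivs(2) rhs g_eq by (auto simp: complex_eq_iff field_simps)
    qed
    show ?thesis using modulus first second by blast
  qed
  have iff: "spherical_condition M x y \<mu> \<longleftrightarrow> (\<forall>w\<in>M. ?\<theta>w w = g w)"
    unfolding spherical_condition_def using pointwise by (intro ball_cong) auto
  have "g holomorphic_on M"
    unfolding g_def using assms(1,4,5,6) by (intro holomorphic_intros holomorphic_deriv) auto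
  then have "harmonic_on \<theta> M" if "spherical_condition M x y \<mu>"
    using laplacian_zero_if_wirt_holomorphic[OF \<open>open M\<close> diff] that iff \<open>smooth_on \<theta> M\<close>
    by (auto simp: harmonic_on_def smooth_on_def)
  then show ?thesis
    using iff by (simp add: g_def)
qed

end
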